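(* Let $\mathbf f=(\mathbf f^{\mathrm P},\mathbf f^{\mathrm M},\mathbf f^{\mathrm V})$ be the nonlinearity of a water distribution network on $\Omega=\Omega^{\mathrm P}\times\Omega^{\mathrm M}\times\Omega^{\mathrm V}$ (as defined in the context), let $K$ be its Lipschitz constant and $L$ its one-sided Lipschitz constant on $\Omega$, and let $K^{\mathrm P},K^{\mathrm M},K^{\mathrm V}$ be the Lipschitz constants of $\mathbf f^{\mathrm P},\mathbf f^{\mathrm M},\mathbf f^{\mathrm V}$ on $\Omega^{\mathrm P},\Omega^{\mathrm M},\Omega^{\mathrm V}$. Then $L$ is identical to $K$, and $$L=\max\{K^{\mathrm P},K^{\mathrm M},K^{\mathrm V}\}.$$
   Context: "The Lipschitz constant" of a function $\mathbf g:D\subseteq\mathbb R^n\to\mathbb R^m$ means the smallest $K\ge 0$ with $\|\mathbf g(\mathbf z_1)-\mathbf g(\mathbf z_2)\|_2\le K\|\mathbf z_1-\mathbf z_2\|_2$ for all $\mathbf z_1,\mathbf z_2\in D$. "The one-sided Lipschitz constant" of $\mathbf g:D\subseteq\mathbb R^n\to\mathbb R^n$ means the smallest (optimal) $L\in\mathbb R$ with $\langle\mathbf g(\mathbf z_1)-\mathbf g(\mathbf z_2),\mathbf z_1-\mathbf z_2\rangle\le L\|\mathbf z_1-\mathbf z_2\|_2^2$ for all $\mathbf z_1,\mathbf z_2\in D$. Norms and inner products are Euclidean. The network has $n_p$ pipes, $n_m$ pumps and $n_v$ valves, with at least one link in total. The flow through each link lies in a compact interval, with $q^{\min}<q^{\max}$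 the bounds for that link; $\Omega^{\mathrm P}\subset\mathbb R^{n_p}$, $\Omega^{\mathrm M}\subset\mathbb R^{n_m}$, $\Omega^{\mathrm V}\subset\mathbb R^{n_v}$ are the Cartesian products of the flow intervals of the pipes, pumps, valves respectively. Each of the three functions below maps the vector of flows through the corresponding links componentwise (so $\mathbf f:\Omega\subset\mathbb R^n\to\mathbb R^n$ with $n=n_p+n_m+n_v$, and each component of $\mathbf f$ depends only on the flow of the same index): - Pipes: $f^{\mathrm P}_i=R^{\mathrm P}_i\,q_i|q_i|^{\mu_{\mathrm P}-1}$, $R^{\mathrm P}_i>0$, $\mu_{\mathrm P}\ge 1$ fixed (the same for all pipes). - Pumps: $f^{\mathrm M}_i=-h_i^{\mathrm s}s_i^2+r_i\,q_i^{\nu_i}s_i^{2-\nu_i}$, with $q_i^{\min}>0$ and $r_i>0$, $s_i\in(0,1]$, $1\le\nu_i\le3$, $h_i^{\mathrm s}>0$ fixed. - Valves: $f^{\mathrm V}_i=o_iR^{\mathrm V}_i\,q_i|q_i|^{\mu_{\mathrm V}-1}$, $R^{\mathrm V}_i>0$, $o_i\in(0,1]$, $1\le\mu_{\mathrm V}\le 3$ fixed ($\mu_{\mathrm V}$ the same for all valves). If a class of links is empty, its Lipschitz constant is taken to be $0$. For an exponent $\mu=1$, powers with exponent $\mu-1=0$ are read as $1$. *)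

theory Defs
  imports Complex_Main "Jordan_Normal_Form.Matrix"
begin

(* Vectors in R^n are elements of carrier_vec n :: real vec set, so that n is an ordinary natural
   number and n = 0 (an empty class of links) is allowed. *)

definition eucl_norm :: "real vec \<Rightarrow> real" where
  "eucl_norm v = sqrt (v \<bullet> v)"

definition lipschitz_bound :: "real vec set \<Rightarrow> (real vec \<Rightarrow> real vec) \<Rightarrow> real \<Rightarrow> bool" where
  "lipschitz_bound D g K \<longleftrightarrow> 0 \<le> K \<and>
     (\<forall>z1\<in>D. \<forall>z2\<in>D. eucl_norm (g z1 - g z2) \<le> K * eucl_norm (z1 - z2))"

definition one_sided_lipschitz_bound ::
    "real vec set \<Rightarrow> (real vec \<Rightarrow> real vec) \<Rightarrow> real \<Rightarrow> bool" where
  "one_sided_lipschitz_bound D g L \<longleftrightarrow>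
     (\<forall>z1\<in>D. \<forall>z2\<in>D. (g z1 - g z2) \<bullet> (z1 - z2) \<le> L * (eucl_norm (z1 - z2))\<^sup>2)"

definition is_smallest :: "(real \<Rightarrow> bool) \<Rightarrow> real \<Rightarrow> bool" where
  "is_smallest P x \<longleftrightarrow> P x \<and> (\<forall>y. P y \<longrightarrow> x \<le> y)"

(* LEAST is unspecified if there is no smallest bound; existence is therefore a separate claim,
   expressed by is_smallest. *)

definition lipschitz_constant :: "real vec set \<Rightarrow> (real vec \<Rightarrow> real vec) \<Rightarrow> real" where
  "lipschitz_constant D g = (LEAST K. lipschitz_bound D g K)"

definition one_sided_lipschitz_constant ::
    "real vec set \<Rightarrow> (real vec \<Rightarrow> real vec) \<Rightarrow> real" where
  "one_sided_lipschitz_constant D g = (LEAST L. one_sided_lipschitz_bound D g L)"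

definition flow_box :: "nat \<Rightarrow> (nat \<Rightarrow> real) \<Rightarrow> (nat \<Rightarrow> real) \<Rightarrow> real vec set" where
  "flow_box n qmin qmax = {q \<in> carrier_vec n. \<forall>i<n. q $ i \<in> {qmin i..qmax i}}"

(* Although 0 powr 0 = 0, the convention |q| powr 0 = 1 at q = 0 would not change the values
   below, because of the factor q. *)

definition pipe_fun :: "nat \<Rightarrow> (nat \<Rightarrow> real) \<Rightarrow> real \<Rightarrow> real vec \<Rightarrow> real vec" where
  "pipe_fun n R \<mu> q = vec n (\<lambda>i. R i * (q $ i) * \<bar>q $ i\<bar> powr (\<mu> - 1))"

definition pump_fun ::
    "nat \<Rightarrow> (nat \<Rightarrow> real) \<Rightarrow> (nat \<Rightarrow> real) \<Rightarrow> (nat \<Rightarrow> real) \<Rightarrow> (nat \<Rightarrow> real) \<Rightarrow> real vec \<Rightarrow> real vec" where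
  "pump_fun n h s r \<nu> q =
     vec n (\<lambda>i. - h i * (s i)\<^sup>2 + r i * (q $ i) powr (\<nu> i) * (s i) powr (2 - \<nu> i))"

definition valve_fun ::
    "nat \<Rightarrow> (nat \<Rightarrow> real) \<Rightarrow> (nat \<Rightarrow> real) \<Rightarrow> real \<Rightarrow> real vec \<Rightarrow> real vec" where
  "valve_fun n op R \<mu> q = vec n (\<lambda>i. op i * R i * (q $ i) * \<bar>q $ i\<bar> powr (\<mu> - 1))"

definition prod3 :: "real vec set \<Rightarrow> real vec set \<Rightarrow> real vec set \<Rightarrow> real vec set" where
  "prod3 A B C = {a @\<^sub>v b @\<^sub>v c | a b c. a \<in> A \<and> b \<in> B \<and> c \<in> C}"

definition blockwise3 ::
    "nat \<Rightarrow> nat \<Rightarrow> nat \<Rightarrow> (real vec \<Rightarrow> real vec) \<Rightarrow> (real vec \<Rightarrow> real vec) \<Rightarrow> (real vec \<Rightarrow> real vec)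
      \<Rightarrow> real vec \<Rightarrow> real vec" where
  "blockwise3 nP nM nV fP fM fV q =
     fP (vec_first q nP) @\<^sub>v fM (vec_first (vec_last q (nM + nV)) nM) @\<^sub>v fV (vec_last q nV)"

lemma blockwise3_append:
  assumes "a \<in> carrier_vec nP" "b \<in> carrier_vec nM" "c \<in> carrier_vec nV"
  shows "blockwise3 nP nM nV fP fM fV (a @\<^sub>v b @\<^sub>v c) = fP a @\<^sub>v fM b @\<^sub>v fV c"
proof -
  have "vec_first (a @\<^sub>v b @\<^sub>v c) nP = a" "vec_last (a @\<^sub>v b @\<^sub>v c) (nM + nV) = b @\<^sub>v c"
       "vec_first (b @\<^sub>v c) nM = b" "vec_last (a @\<^sub>v b @\<^sub>v c) nV = c"
    using assms by (auto simp: vec_first_def vec_last_def)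
  then show ?thesis by (simp add: blockwise3_def)
qed

lemma lipschitz_constant_eqI:
  assumes "is_smallest (lipschitz_bound D g) K"
  shows "lipschitz_constant D g = K"
  using assms unfolding is_smallest_def lipschitz_constant_def by (intro Least_equality) auto

lemma lipschitz_constant_flow_box_0: "lipschitz_constant (flow_box 0 qmin qmax) g = 0"
proof (rule lipschitz_constant_eqI)
  have eq: "z1 = z2" if "z1 \<in> flow_box 0 qmin qmax" "z2 \<in> flow_box 0 qmin qmax" for z1 z2
    using that by (auto simp: flow_box_def)
  have norm0: "eucl_norm (v - v) = 0" for v :: "real vec"
    by (simp add: eucl_norm_def scalar_prod_def)
  have "eucl_norm (g z1 - g z2) \<le> 0 * eucl_norm (z1 - z2)"
    if "z1 \<in> flow_box 0 qmin qmax" "z2 \<in> flow_box 0 qmin qmax" for z1 z2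
    using eq[OF that] norm0 by simp
  then show "is_smallest (lipschitz_bound (flow_box 0 qmin qmax) g) 0"
    by (auto simp: is_smallest_def lipschitz_bound_def)
qed

end

theory Submission
  imports Defs
begin

text \<open>
  The flow in a link only influences the head loss of that link, and it does so through a
  nondecreasing scalar function. For a map of this shape, the Lipschitz condition and the one-sided
  Lipschitz condition with constant \<open>K\<close> say the same thing: in every coordinate, no secant has a
  slope above \<open>K\<close>. Necessity is seen on pairs of points that differ in one coordinate, where the norm
  and the inner product collapse to that coordinate. Sufficiency follows by summing the coordinatewise
  estimates; for the norm this is where monotonicity enters, since it turns an upper bound on slopes
  into a bound on their absolute values. Hence the two families of admissible constants coincide,
  except that a Lipschitz bound is nonnegative by definition. As soon as there is a link, monotonicity
  forces the one-sided bounds to be nonnegative as well, so \<open>L = K\<close>.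

  The same criterion shows that \<open>K\<close> is admissible for the network iff it is admissible for the
  pipes, for the pumps and for the valves, which gives the maximum formula. That smallest
  constants exist at all holds because the set of Lipschitz bounds is closed and, as the next
  observation shows, not empty.

  All three types of links are covered by one scalar model: up to an additive constant and a positive
  factor, each is \<open>x * \<bar>x\<bar> powr (m - 1)\<close> with \<open>m \<ge> 1\<close>, which is nondecreasing and
  has slopes at most \<open>m * M powr (m - 1)\<close> on \<open>[-M, M]\<close>. For the pumps this uses that
  their flows are positive.
\<close>

section \<open>Smallest Lipschitz bounds\<close>

lemma eucl_norm_nonneg: "0 \<le> eucl_norm v"
  by (simp add: eucl_norm_def scalar_prod_def sum_nonneg)

lemma eucl_norm_sq: "(eucl_norm v)\<^sup>2 = v \<bullet> v"
  by (simp add: eucl_norm_def scalar_prod_def sum_nonneg)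

text \<open>
  The infimum of all Lipschitz bounds is again a Lipschitz bound, because each pair of points
  contributes a closed condition on the constant.
\<close>

lemma is_smallest_lipschitz_constant:
  assumes "lipschitz_bound D g K0"
  shows "is_smallest (lipschitz_bound D g) (lipschitz_constant D g)"
proof -
  let ?S = "{K. lipschitz_bound D g K}"
  have ne: "?S \<noteq> {}" and bdd: "bdd_below ?S"
    using assms by (auto simp: lipschitz_bound_def intro!: bdd_belowI[of _ 0])
  have "eucl_norm (g z1 - g z2) \<le> Inf ?S * eucl_norm (z1 - z2)" if z: "z1 \<in> D" "z2 \<in> D" for z1 z2
  proof (cases "eucl_norm (z1 - z2) = 0")
    case True
    moreover have "eucl_norm (g z1 - g z2) \<le> K0 * eucl_norm (z1 - z2)"
      using assms z unfolding lipschitz_bound_def by blast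
    ultimately show ?thesis by simp
  next
    case False
    then have pos: "0 < eucl_norm (z1 - z2)" using eucl_norm_nonneg[of "z1 - z2"] by simp
    have "eucl_norm (g z1 - g z2) / eucl_norm (z1 - z2) \<le> Inf ?S"
      by (intro cInf_greatest[OF ne]) (use z pos in \<open>simp add: lipschitz_bound_def divide_le_eq\<close>)
    then show ?thesis using pos by (simp add: divide_le_eq)
  qed
  moreover have "0 \<le> Inf ?S"
    by (intro cInf_greatest[OF ne]) (auto simp: lipschitz_bound_def)
  ultimately have "lipschitz_bound D g (Inf ?S)" unfolding lipschitz_bound_def by blast
  moreover have "Inf ?S \<le> K" if "lipschitz_bound D g K" for K
    using that by (intro cInf_lower[OF _ bdd]) simp
  ultimately have "is_smallest (lipschitz_bound D g) (Inf ?S)" unfolding is_smallest_def by blast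
  then show ?thesis by (simp add: lipschitz_constant_eqI)
qed

lemma lipschitz_bound_mono:
  assumes "lipschitz_bound D g K" "K \<le> K'"
  shows "lipschitz_bound D g K'"
  unfolding lipschitz_bound_def
proof (intro conjI ballI)
  show "0 \<le> K'" using assms by (auto simp: lipschitz_bound_def)
  fix z1 z2 assume "z1 \<in> D" "z2 \<in> D"
  then have "eucl_norm (g z1 - g z2) \<le> K * eucl_norm (z1 - z2)"
    using assms by (auto simp: lipschitz_bound_def)
  also have "\<dots> \<le> K' * eucl_norm (z1 - z2)"
    by (intro mult_right_mono assms eucl_norm_nonneg)
  finally show "eucl_norm (g z1 - g z2) \<le> K' * eucl_norm (z1 - z2)" .
qed

lemma lipschitz_bound_iff_ge_smallest:
  assumes "is_smallest (lipschitz_bound D g) K0"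
  shows "lipschitz_bound D g K \<longleftrightarrow> K0 \<le> K"
  using assms lipschitz_bound_mono[of D g K0 K] unfolding is_smallest_def by blast

section \<open>Separable nondecreasing maps on a box\<close>

definition secant_bound :: "real \<Rightarrow> real \<Rightarrow> (real \<Rightarrow> real) \<Rightarrow> real \<Rightarrow> bool" where
  "secant_bound a b \<phi> K \<longleftrightarrow> (\<forall>x\<in>{a..b}. \<forall>y\<in>{a..b}. x \<le> y \<longrightarrow> \<phi> y - \<phi> x \<le> K * (y - x))"

lemma secant_bound_mono:
  assumes "secant_bound a b \<phi> K" "K \<le> K'"
  shows "secant_bound a b \<phi> K'"
  unfolding secant_bound_def
proof (intro ballI impI)
  fix x y assume xy: "x \<in> {a..b}" "y \<in> {a..b}" "x \<le> y"
  then have "\<phi> y - \<phi> x \<le> K * (y - x)" using assms by (auto simp: secant_bound_def)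
  also have "\<dots> \<le> K' * (y - x)" using assms xy by (intro mult_right_mono) auto
  finally show "\<phi> y - \<phi> x \<le> K' * (y - x)" .
qed

lemma secant_bound_nonneg:
  assumes "secant_bound a b \<phi> K" "mono_on {a..b} \<phi>" "a < b"
  shows "0 \<le> K"
proof -
  have "0 \<le> \<phi> b - \<phi> a" using assms by (auto simp: mono_on_def)
  also have "\<dots> \<le> K * (b - a)" using assms by (auto simp: secant_bound_def)
  finally show ?thesis using \<open>a < b\<close> by (simp add: zero_le_mult_iff)
qed

lemma secant_bound_inner:
  assumes "secant_bound a b \<phi> K" "x \<in> {a..b}" "y \<in> {a..b}"
  shows "(\<phi> x - \<phi> y) * (x - y) \<le> K * ((x - y) * (x - y))"
proof (cases "x \<le> y")
  case True
  then have "(\<phi> y - \<phi> x) * (y - x) \<le> K * (y - x) * (y - x)"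
    using assms by (intro mult_right_mono) (auto simp: secant_bound_def)
  then show ?thesis by (simp add: algebra_simps)
next
  case False
  then have "(\<phi> x - \<phi> y) * (x - y) \<le> K * (x - y) * (x - y)"
    using assms by (intro mult_right_mono) (auto simp: secant_bound_def)
  then show ?thesis by (simp add: algebra_simps)
qed

lemma secant_bound_square:
  assumes "secant_bound a b \<phi> K" "mono_on {a..b} \<phi>" "x \<in> {a..b}" "y \<in> {a..b}"
  shows "(\<phi> x - \<phi> y) * (\<phi> x - \<phi> y) \<le> K\<^sup>2 * ((x - y) * (x - y))"
proof -
  have *: "(\<phi> v - \<phi> u)\<^sup>2 \<le> (K * (v - u))\<^sup>2" if "u \<in> {a..b}" "v \<in> {a..b}" "u \<le> v" for u v
    using that assms(1,2) by (intro power_mono) (auto simp: secant_bound_def mono_on_def)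
  have "(\<phi> x - \<phi> y)\<^sup>2 \<le> (K * (x - y))\<^sup>2"
    using *[of x y] *[of y x] assms(3,4)
    by (cases "x \<le> y") (auto simp: power2_commute power_mult_distrib)
  then show ?thesis by (simp add: power2_eq_square mult_ac)
qed

lemma scalar_prod_single_coordinate:
  fixes u v :: "real vec"
  assumes "v \<in> carrier_vec n" "i < n" "\<And>j. j < n \<Longrightarrow> j \<noteq> i \<Longrightarrow> u $ j = 0"
  shows "u \<bullet> v = u $ i * v $ i"
proof -
  have "u \<bullet> v = (\<Sum>j\<in>{0..<n}. u $ j * v $ j)" using assms by (simp add: scalar_prod_def)
  also have "\<dots> = (\<Sum>j\<in>{i}. u $ j * v $ j)" using assms by (intro sum.mono_neutral_right) auto
  finally show ?thesis by simp
qed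

locale increasing_separable =
  fixes n :: nat and lo hi :: "nat \<Rightarrow> real" and \<phi> :: "nat \<Rightarrow> real \<Rightarrow> real"
    and g :: "real vec \<Rightarrow> real vec"
  assumes nondegenerate: "i < n \<Longrightarrow> lo i < hi i"
    and mono: "i < n \<Longrightarrow> mono_on {lo i..hi i} (\<phi> i)"
    and secant_bounded: "i < n \<Longrightarrow> \<exists>K. secant_bound (lo i) (hi i) (\<phi> i) K"
    and separable: "z \<in> flow_box n lo hi \<Longrightarrow> g z = vec n (\<lambda>i. \<phi> i (z $ i))"
begin

text \<open>
  Test points for necessity: the coordinates other than \<open>i\<close> are parked at their lower bounds, so
  that secants of the single function \<open>\<phi> i\<close> appear as differences of values of \<open>g\<close>.
\<close>

definition probe :: "nat \<Rightarrow> real \<Rightarrow> real vec" where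
  "probe i x = vec n (\<lambda>j. if j = i then x else lo j)"

lemma probe_in_box: "i < n \<Longrightarrow> x \<in> {lo i..hi i} \<Longrightarrow> probe i x \<in> flow_box n lo hi"
  using nondegenerate by (auto simp: probe_def flow_box_def less_imp_le)

lemma probe_inner:
  assumes "i < n" "x \<in> {lo i..hi i}" "y \<in> {lo i..hi i}"
  shows "(probe i x - probe i y) \<bullet> (probe i x - probe i y) = (x - y)\<^sup>2"
    and "(g (probe i x) - g (probe i y)) \<bullet> (probe i x - probe i y) = (\<phi> i x - \<phi> i y) * (x - y)"
    and "(g (probe i x) - g (probe i y)) \<bullet> (g (probe i x) - g (probe i y)) = (\<phi> i x - \<phi> i y)\<^sup>2"
  unfolding separable[OF probe_in_box[OF assms(1,2)]] separable[OF probe_in_box[OF assms(1,3)]]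
  by (subst scalar_prod_single_coordinate[where n = n and i = i];
      simp add: probe_def assms power2_eq_square)+

lemma inner_difference:
  assumes "z1 \<in> flow_box n lo hi" "z2 \<in> flow_box n lo hi"
  shows "(z1 - z2) \<bullet> (z1 - z2) = (\<Sum>i\<in>{0..<n}. (z1 $ i - z2 $ i) * (z1 $ i - z2 $ i))"
    and "(g z1 - g z2) \<bullet> (z1 - z2)
           = (\<Sum>i\<in>{0..<n}. (\<phi> i (z1 $ i) - \<phi> i (z2 $ i)) * (z1 $ i - z2 $ i))"
    and "(g z1 - g z2) \<bullet> (g z1 - g z2)
           = (\<Sum>i\<in>{0..<n}. (\<phi> i (z1 $ i) - \<phi> i (z2 $ i)) * (\<phi> i (z1 $ i) - \<phi> i (z2 $ i)))"
  using assms by (auto simp: separable scalar_prod_def flow_box_def intro!: sum.cong)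

theorem one_sided_lipschitz_bound_iff:
  "one_sided_lipschitz_bound (flow_box n lo hi) g K \<longleftrightarrow>
     (\<forall>i<n. secant_bound (lo i) (hi i) (\<phi> i) K)"
proof
  assume one_sided: "one_sided_lipschitz_bound (flow_box n lo hi) g K"
  have "\<phi> i y - \<phi> i x \<le> K * (y - x)"
    if "i < n" "x \<in> {lo i..hi i}" "y \<in> {lo i..hi i}" "x \<le> y" for i x y
  proof (cases "x = y")
    case False
    then have "x < y" using \<open>x \<le> y\<close> by simp
    have "(\<phi> i y - \<phi> i x) * (y - x) \<le> K * (y - x)\<^sup>2"
      using one_sided probe_in_box[OF that(1,2)] probe_in_box[OF that(1,3)]
        probe_inner[OF that(1,3,2)]
      by (fastforce simp: one_sided_lipschitz_bound_def eucl_norm_sq)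
    then have "(\<phi> i y - \<phi> i x) * (y - x) \<le> (K * (y - x)) * (y - x)"
      by (simp add: power2_eq_square)
    then show ?thesis using \<open>x < y\<close> by simp
  qed simp
  then show "\<forall>i<n. secant_bound (lo i) (hi i) (\<phi> i) K" by (auto simp: secant_bound_def)
next
  assume slopes: "\<forall>i<n. secant_bound (lo i) (hi i) (\<phi> i) K"
  show "one_sided_lipschitz_bound (flow_box n lo hi) g K"
    unfolding one_sided_lipschitz_bound_def eucl_norm_sq
  proof (intro ballI)
    fix z1 z2 assume z: "z1 \<in> flow_box n lo hi" "z2 \<in> flow_box n lo hi"
    show "(g z1 - g z2) \<bullet> (z1 - z2) \<le> K * ((z1 - z2) \<bullet> (z1 - z2))"
      unfolding inner_difference[OF z] sum_distrib_left
      using z slopes by (intro sum_mono secant_bound_inner) (auto simp: flow_box_def)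
  qed
qed

text \<open>
  The explicit condition \<open>0 \<le> K\<close> makes the criterion correct for \<open>n = 0\<close> as well. An empty class of
  links then has the smallest bound \<open>0\<close>, which leaves the maximum over the classes unchanged.
\<close>

theorem lipschitz_bound_iff:
  "lipschitz_bound (flow_box n lo hi) g K \<longleftrightarrow>
     0 \<le> K \<and> (\<forall>i<n. secant_bound (lo i) (hi i) (\<phi> i) K)"
proof
  assume lip: "lipschitz_bound (flow_box n lo hi) g K"
  have "\<phi> i y - \<phi> i x \<le> K * (y - x)"
    if "i < n" "x \<in> {lo i..hi i}" "y \<in> {lo i..hi i}" "x \<le> y" for i x y
  proof -
    have "\<bar>\<phi> i y - \<phi> i x\<bar> = eucl_norm (g (probe i y) - g (probe i x))"
      using probe_inner[OF that(1,3,2)] by (simp add: eucl_norm_def)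
    also have "\<dots> \<le> K * eucl_norm (probe i y - probe i x)"
      using lip probe_in_box[OF that(1,2)] probe_in_box[OF that(1,3)]
      by (auto simp: lipschitz_bound_def)
    also have "eucl_norm (probe i y - probe i x) = y - x"
      using probe_inner[OF that(1,3,2)] \<open>x \<le> y\<close> by (simp add: eucl_norm_def)
    finally show ?thesis by simp
  qed
  then show "0 \<le> K \<and> (\<forall>i<n. secant_bound (lo i) (hi i) (\<phi> i) K)"
    using lip by (auto simp: secant_bound_def lipschitz_bound_def)
next
  assume slopes: "0 \<le> K \<and> (\<forall>i<n. secant_bound (lo i) (hi i) (\<phi> i) K)"
  show "lipschitz_bound (flow_box n lo hi) g K"
    unfolding lipschitz_bound_def
  proof (intro conjI ballI)
    fix z1 z2 assume z: "z1 \<in> flow_box n lo hi" "z2 \<in> flow_box n lo hi"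
    have "(g z1 - g z2) \<bullet> (g z1 - g z2) \<le> K\<^sup>2 * ((z1 - z2) \<bullet> (z1 - z2))"
      unfolding inner_difference[OF z] sum_distrib_left
      using z slopes by (intro sum_mono secant_bound_square) (auto simp: flow_box_def mono)
    then have "(eucl_norm (g z1 - g z2))\<^sup>2 \<le> (K * eucl_norm (z1 - z2))\<^sup>2"
      by (simp add: power_mult_distrib eucl_norm_sq)
    then show "eucl_norm (g z1 - g z2) \<le> K * eucl_norm (z1 - z2)"
      using slopes eucl_norm_nonneg by (meson mult_nonneg_nonneg power2_le_imp_le)
  qed (use slopes in simp)
qed

lemma lipschitz_bound_ex: "\<exists>K. lipschitz_bound (flow_box n lo hi) g K"
proof -
  obtain k where k: "\<And>i. i < n \<Longrightarrow> secant_bound (lo i) (hi i) (\<phi> i) (k i)"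
    using secant_bounded by metis
  have nonneg: "0 \<le> k i" if "i < n" for i
    using that k mono nondegenerate secant_bound_nonneg by blast
  have "k i \<le> sum k {..<n}" if "i < n" for i
    using that nonneg by (intro member_le_sum) auto
  then have "\<forall>i<n. secant_bound (lo i) (hi i) (\<phi> i) (sum k {..<n})"
    using secant_bound_mono[OF k] by blast
  moreover have "0 \<le> sum k {..<n}" using nonneg by (intro sum_nonneg) auto
  ultimately have "lipschitz_bound (flow_box n lo hi) g (sum k {..<n})"
    unfolding lipschitz_bound_iff by simp
  then show ?thesis ..
qed

lemma is_smallest_lipschitz_constant_box:
  "is_smallest (lipschitz_bound (flow_box n lo hi) g) (lipschitz_constant (flow_box n lo hi) g)"
  using lipschitz_bound_ex is_smallest_lipschitz_constant by blast

text \<open>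
  On the zero-dimensional box every real number is a one-sided Lipschitz bound, so there the
  equivalence fails.
\<close>

theorem one_sided_lipschitz_bound_eq_lipschitz_bound:
  assumes "0 < n"
  shows "one_sided_lipschitz_bound (flow_box n lo hi) g = lipschitz_bound (flow_box n lo hi) g"
proof
  fix K
  have "0 \<le> K" if "\<forall>i<n. secant_bound (lo i) (hi i) (\<phi> i) K"
    using that assms secant_bound_nonneg[OF _ mono nondegenerate, of 0] by blast
  then show "one_sided_lipschitz_bound (flow_box n lo hi) g K
      = lipschitz_bound (flow_box n lo hi) g K"
    unfolding one_sided_lipschitz_bound_iff lipschitz_bound_iff by blast
qed

end

section \<open>Concatenation of blocks\<close>

definition cat :: "nat \<Rightarrow> (nat \<Rightarrow> 'a) \<Rightarrow> (nat \<Rightarrow> 'a) \<Rightarrow> nat \<Rightarrow> 'a" where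
  "cat n a b i = (if i < n then a i else b (i - n))"

lemma cat_simps [simp]: "i < n \<Longrightarrow> cat n a b i = a i" "cat n a b (n + j) = b j"
  by (auto simp: cat_def)

lemma all_less_add_iff:
  "(\<forall>i<n + m. P i) \<longleftrightarrow> (\<forall>i<n. P i) \<and> (\<forall>j<m. P (n + j))" for n m :: nat
  by (metis add_less_cancel_left le_add_diff_inverse not_less trans_less_add1)

lemma append_in_flow_box_iff:
  assumes "a \<in> carrier_vec n" "b \<in> carrier_vec m"
  shows "a @\<^sub>v b \<in> flow_box (n + m) (cat n lo1 lo2) (cat n hi1 hi2) \<longleftrightarrow>
           a \<in> flow_box n lo1 hi1 \<and> b \<in> flow_box m lo2 hi2"
  using assms by (auto simp: flow_box_def all_less_add_iff)

lemma prod3_flow_box: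
  "prod3 (flow_box n1 lo1 hi1) (flow_box n2 lo2 hi2) (flow_box n3 lo3 hi3)
     = flow_box (n1 + (n2 + n3)) (cat n1 lo1 (cat n2 lo2 lo3)) (cat n1 hi1 (cat n2 hi2 hi3))"
  (is "?prod = ?box")
proof (intro subset_antisym subsetI)
  fix z assume "z \<in> ?prod"
  then obtain a b c where z: "z = a @\<^sub>v b @\<^sub>v c"
    and abc: "a \<in> flow_box n1 lo1 hi1" "b \<in> flow_box n2 lo2 hi2" "c \<in> flow_box n3 lo3 hi3"
    by (auto simp: prod3_def)
  moreover have "a \<in> carrier_vec n1" "b \<in> carrier_vec n2" "c \<in> carrier_vec n3"
    using abc by (auto simp: flow_box_def)
  ultimately show "z \<in> ?box" by (simp add: append_in_flow_box_iff)
next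
  fix z assume z: "z \<in> ?box"
  define a where "a = vec_first z n1"
  define b where "b = vec_first (vec_last z (n2 + n3)) n2"
  define c where "c = vec_last (vec_last z (n2 + n3)) n3"
  have carrier: "a \<in> carrier_vec n1" "b \<in> carrier_vec n2" "c \<in> carrier_vec n3"
    by (simp_all add: a_def b_def c_def)
  have "z \<in> carrier_vec (n1 + (n2 + n3))" using z by (simp add: flow_box_def)
  then have eq: "z = a @\<^sub>v b @\<^sub>v c" by (simp add: a_def b_def c_def)
  then show "z \<in> ?prod"
    using z carrier by (auto simp: append_in_flow_box_iff prod3_def)
qed

lemma increasing_separable_blockwise3:
  assumes "increasing_separable n1 lo1 hi1 \<phi>1 g1"
    and "increasing_separable n2 lo2 hi2 \<phi>2 g2"
    and "increasing_separable n3 lo3 hi3 \<phi>3 g3"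
  shows "increasing_separable (n1 + (n2 + n3))
           (cat n1 lo1 (cat n2 lo2 lo3)) (cat n1 hi1 (cat n2 hi2 hi3))
           (cat n1 \<phi>1 (cat n2 \<phi>2 \<phi>3)) (blockwise3 n1 n2 n3 g1 g2 g3)"
    (is "increasing_separable ?n ?lo ?hi ?\<phi> ?g")
proof -
  interpret B1: increasing_separable n1 lo1 hi1 \<phi>1 g1 by fact
  interpret B2: increasing_separable n2 lo2 hi2 \<phi>2 g2 by fact
  interpret B3: increasing_separable n3 lo3 hi3 \<phi>3 g3 by fact
  have "\<forall>i<?n. ?lo i < ?hi i \<and> mono_on {?lo i..?hi i} (?\<phi> i) \<and>
          (\<exists>K. secant_bound (?lo i) (?hi i) (?\<phi> i) K)"
    unfolding all_less_add_iff
    by (simp add: B1.nondegenerate B2.nondegenerate B3.nondegenerate B1.mono B2.mono B3.mono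
        B1.secant_bounded B2.secant_bounded B3.secant_bounded)
  moreover have "?g z = vec ?n (\<lambda>i. ?\<phi> i (z $ i))" if z: "z \<in> flow_box ?n ?lo ?hi" for z
  proof -
    obtain a b c where abc_eq: "z = a @\<^sub>v b @\<^sub>v c"
      and abc: "a \<in> flow_box n1 lo1 hi1" "b \<in> flow_box n2 lo2 hi2" "c \<in> flow_box n3 lo3 hi3"
      using z unfolding prod3_flow_box[symmetric] by (auto simp: prod3_def)
    have carrier: "a \<in> carrier_vec n1" "b \<in> carrier_vec n2" "c \<in> carrier_vec n3"
      using abc by (auto simp: flow_box_def)
    have "?g z = g1 a @\<^sub>v g2 b @\<^sub>v g3 c"
      unfolding abc_eq by (rule blockwise3_append[OF carrier])
    moreover have "\<forall>i<?n. (g1 a @\<^sub>v g2 b @\<^sub>v g3 c) $ i = ?\<phi> i (z $ i)"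
      unfolding all_less_add_iff using carrier
      by (simp add: abc_eq B1.separable[OF abc(1)] B2.separable[OF abc(2)] B3.separable[OF abc(3)])
    ultimately show ?thesis
      by (intro eq_vecI)
        (simp_all add: B1.separable[OF abc(1)] B2.separable[OF abc(2)] B3.separable[OF abc(3)])
  qed
  ultimately show ?thesis unfolding increasing_separable_def by blast
qed

section \<open>Signed power laws\<close>

definition signed_power :: "real \<Rightarrow> real \<Rightarrow> real" where
  "signed_power m x = x * \<bar>x\<bar> powr (m - 1)"

lemma signed_power_minus: "signed_power m (- x) = - signed_power m x"
  by (simp add: signed_power_def)

lemma signed_power_0: "signed_power m 0 = 0"
  by (simp add: signed_power_def)

lemma signed_power_eq_powr: "0 < x \<Longrightarrow> signed_power m x = x powr m"
  by (simp add: signed_power_def powr_mult_base)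

lemma signed_power_increment_nonneg:
  assumes "1 \<le> m" "0 \<le> x" "x \<le> y" "y \<le> M"
  shows "0 \<le> signed_power m y - signed_power m x"
    and "signed_power m y - signed_power m x \<le> m * M powr (m - 1) * (y - x)"
proof -
  have "x * x powr (m - 1) \<le> y * y powr (m - 1)"
    using assms by (intro mult_mono powr_mono2) auto
  then show "0 \<le> signed_power m y - signed_power m x" using assms by (simp add: signed_power_def)
  have M: "t powr (m - 1) \<le> M powr (m - 1)" if "0 \<le> t" "t \<le> y" for t
    using that assms by (intro powr_mono2) auto
  show "signed_power m y - signed_power m x \<le> m * M powr (m - 1) * (y - x)"
    \<comment> \<open>The mean value theorem needs \<open>0 < x\<close>, since \<open>powr m\<close> is differentiated at positive arguments only.\<close>
  proof (cases "0 < x \<and> x < y")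
    case True
    then have "\<exists>t. x < t \<and> t < y \<and> y powr m - x powr m = (y - x) * (m * t powr (m - 1))"
      by (intro MVT2) (auto intro!: derivative_eq_intros simp: powr_diff field_simps)
    then obtain t where t: "x < t" "t < y" "y powr m - x powr m = (y - x) * (m * t powr (m - 1))"
      by blast
    have "(y - x) * (m * t powr (m - 1)) \<le> (y - x) * (m * M powr (m - 1))"
      using t True assms M[of t] by (intro mult_left_mono) auto
    then show ?thesis using True t by (simp add: signed_power_eq_powr mult_ac)
  next
    case False
    then consider "x = y" | "x = 0" "0 \<le> y" using assms by linarith
    then show ?thesis
    proof cases
      case 2
      have "y * y powr (m - 1) \<le> y * (m * M powr (m - 1))"
        using 2 assms M[of y] mult_mono[of 1 m "y powr (m - 1)" "M powr (m - 1)"]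
        by (intro mult_left_mono) auto
      then show ?thesis using 2 by (simp add: signed_power_def mult_ac)
    qed simp
  qed
qed

text \<open>
  Oddness reduces negative arguments to positive ones; an interval with \<open>0\<close> in its interior is
  split at \<open>0\<close>. This avoids differentiating at \<open>0\<close>.
\<close>

lemma signed_power_increment:
  assumes "1 \<le> m" "- M \<le> x" "x \<le> y" "y \<le> M"
  shows "0 \<le> signed_power m y - signed_power m x \<and>
         signed_power m y - signed_power m x \<le> m * M powr (m - 1) * (y - x)"
proof -
  note inc = signed_power_increment_nonneg[OF \<open>1 \<le> m\<close>]
  consider "0 \<le> x" | "y \<le> 0" | "x \<le> 0" "0 \<le> y" by linarith
  then show ?thesis
  proof cases
    case 1
    then show ?thesis using inc[of x y M] assms by simp
  next
    case 2
    then show ?thesis using inc[of "- y" "- x" M] assms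
      by (simp add: signed_power_minus algebra_simps)
  next
    case 3
    then show ?thesis using inc[of 0 y M] inc[of 0 "- x" M] assms
      by (simp add: signed_power_minus signed_power_0 algebra_simps)
  qed
qed

lemma affine_signed_power:
  assumes \<phi>: "\<And>x. x \<in> {a..b} \<Longrightarrow> \<phi> x = d + c * signed_power m x" and "0 \<le> c" "1 \<le> m"
  shows "mono_on {a..b} \<phi>" and "\<exists>K. secant_bound a b \<phi> K"
proof -
  define M where "M = max \<bar>a\<bar> \<bar>b\<bar>"
  have inc: "0 \<le> \<phi> y - \<phi> x \<and> \<phi> y - \<phi> x \<le> c * (m * M powr (m - 1)) * (y - x)"
    if "x \<in> {a..b}" "y \<in> {a..b}" "x \<le> y" for x y
  proof -
    have eq: "\<phi> y - \<phi> x = c * (signed_power m y - signed_power m x)"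
      using \<phi> that by (simp add: algebra_simps)
    have "- M \<le> x" "y \<le> M" using that by (auto simp: M_def)
    then have "0 \<le> signed_power m y - signed_power m x \<and>
        signed_power m y - signed_power m x \<le> m * M powr (m - 1) * (y - x)"
      using signed_power_increment \<open>1 \<le> m\<close> \<open>x \<le> y\<close> by blast
    then show ?thesis
      unfolding eq mult.assoc using \<open>0 \<le> c\<close>
      by (intro conjI mult_nonneg_nonneg mult_left_mono) (auto simp: mult_ac)
  qed
  show "mono_on {a..b} \<phi>" using inc by (fastforce simp: mono_on_def)
  show "\<exists>K. secant_bound a b \<phi> K" using inc unfolding secant_bound_def by blast
qed

lemma increasing_separable_power_law:
  assumes "\<And>i. i < n \<Longrightarrow> lo i < hi i \<and> 0 \<le> c i \<and> 1 \<le> m i"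
    and "\<And>i x. i < n \<Longrightarrow> x \<in> {lo i..hi i} \<Longrightarrow> \<phi> i x = d i + c i * signed_power (m i) x"
    and "\<And>z. z \<in> flow_box n lo hi \<Longrightarrow> g z = vec n (\<lambda>i. \<phi> i (z $ i))"
  shows "increasing_separable n lo hi \<phi> g"
proof unfold_locales
  fix i assume i: "i < n"
  note affine_signed_power[of "lo i" "hi i" "\<phi> i" "d i" "c i" "m i"]
  then show "mono_on {lo i..hi i} (\<phi> i)" "\<exists>K. secant_bound (lo i) (hi i) (\<phi> i) K"
    using assms(1)[OF i] assms(2)[OF i] by blast+
qed (use assms in blast)+

section \<open>The water distribution network\<close>

theorem proposition4:
  fixes nP nM nV :: nat
    and qminP qmaxP qminM qmaxM qminV qmaxV :: "nat \<Rightarrow> real"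
    and RP h s r \<nu> op RV :: "nat \<Rightarrow> real"
    and \<mu>P \<mu>V :: real
    and \<Omega>P \<Omega>M \<Omega>V \<Omega> :: "real vec set"
    and fP fM fV f :: "real vec \<Rightarrow> real vec"
    and K L KP KM KV :: real
  assumes links: "nP + nM + nV \<ge> 1"
    and pipes: "\<And>i. i < nP \<Longrightarrow> qminP i < qmaxP i \<and> RP i > 0"
    and muP: "\<mu>P \<ge> 1"
    and pumps: "\<And>i. i < nM \<Longrightarrow> 0 < qminM i \<and> qminM i < qmaxM i \<and> r i > 0 \<and>
                  s i \<in> {0<..1} \<and> \<nu> i \<in> {1..3} \<and> h i > 0"
    and valves: "\<And>i. i < nV \<Longrightarrow> qminV i < qmaxV i \<and> RV i > 0 \<and> op i \<in> {0<..1}"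
    and muV: "\<mu>V \<in> {1..3}"
    and \<Omega>P: "\<Omega>P = flow_box nP qminP qmaxP"
    and \<Omega>M: "\<Omega>M = flow_box nM qminM qmaxM"
    and \<Omega>V: "\<Omega>V = flow_box nV qminV qmaxV"
    and \<Omega>: "\<Omega> = prod3 \<Omega>P \<Omega>M \<Omega>V"
    and fP: "fP = pipe_fun nP RP \<mu>P"
    and fM: "fM = pump_fun nM h s r \<nu>"
    and fV: "fV = valve_fun nV op RV \<mu>V"
    and f: "f = blockwise3 nP nM nV fP fM fV"
    and K: "K = lipschitz_constant \<Omega> f"
    and L: "L = one_sided_lipschitz_constant \<Omega> f"
    and KP: "KP = lipschitz_constant \<Omega>P fP"
    and KM: "KM = lipschitz_constant \<Omega>M fM"
    and KV: "KV = lipschitz_constant \<Omega>V fV"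
  shows "is_smallest (lipschitz_bound \<Omega> f) K
       \<and> is_smallest (one_sided_lipschitz_bound \<Omega> f) L
       \<and> is_smallest (lipschitz_bound \<Omega>P fP) KP
       \<and> is_smallest (lipschitz_bound \<Omega>M fM) KM
       \<and> is_smallest (lipschitz_bound \<Omega>V fV) KV
       \<and> L = K \<and> L = Max {KP, KM, KV}"
proof -
  interpret P: increasing_separable nP qminP qmaxP "\<lambda>i x. RP i * x * \<bar>x\<bar> powr (\<mu>P - 1)" fP
    by (rule increasing_separable_power_law[where c = RP and d = "\<lambda>_. 0" and m = "\<lambda>_. \<mu>P"])
      (use pipes muP in \<open>auto simp: fP pipe_fun_def signed_power_def less_imp_le\<close>)
  interpret M: increasing_separable nM qminM qmaxM
      "\<lambda>i x. - h i * (s i)\<^sup>2 + r i * x powr (\<nu> i) * (s i) powr (2 - \<nu> i)" fM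
  proof (rule increasing_separable_power_law[where c = "\<lambda>i. r i * s i powr (2 - \<nu> i)"
        and d = "\<lambda>i. - h i * (s i)\<^sup>2" and m = \<nu>])
    fix i x assume "i < nM" "x \<in> {qminM i..qmaxM i}"
    then have "0 < x" using pumps[of i] by auto
    then show "- h i * (s i)\<^sup>2 + r i * x powr (\<nu> i) * (s i) powr (2 - \<nu> i)
        = - h i * (s i)\<^sup>2 + r i * s i powr (2 - \<nu> i) * signed_power (\<nu> i) x"
      by (simp add: signed_power_eq_powr)
  qed (use pumps in \<open>auto simp: fM pump_fun_def less_imp_le\<close>)
  interpret V: increasing_separable nV qminV qmaxV "\<lambda>i x. op i * RV i * x * \<bar>x\<bar> powr (\<mu>V - 1)" fV
    by (rule increasing_separable_power_law[where c = "\<lambda>i. op i * RV i" and d = "\<lambda>_. 0"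
          and m = "\<lambda>_. \<mu>V"])
      (use valves muV in \<open>auto simp: fV valve_fun_def signed_power_def less_imp_le\<close>)
  note blocks = P.increasing_separable_axioms M.increasing_separable_axioms
    V.increasing_separable_axioms
  interpret N: increasing_separable "nP + (nM + nV)" "cat nP qminP (cat nM qminM qminV)"
      "cat nP qmaxP (cat nM qmaxM qmaxV)"
      "cat nP (\<lambda>i x. RP i * x * \<bar>x\<bar> powr (\<mu>P - 1))
        (cat nM (\<lambda>i x. - h i * (s i)\<^sup>2 + r i * x powr (\<nu> i) * (s i) powr (2 - \<nu> i))
           (\<lambda>i x. op i * RV i * x * \<bar>x\<bar> powr (\<mu>V - 1)))" f
    unfolding f by (rule increasing_separable_blockwise3[OF blocks])
  note \<Omega>_box = \<Omega>[unfolded \<Omega>P \<Omega>M \<Omega>V prod3_flow_box]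
  have sP: "is_smallest (lipschitz_bound \<Omega>P fP) KP"
    unfolding KP \<Omega>P by (rule P.is_smallest_lipschitz_constant_box)
  have sM: "is_smallest (lipschitz_bound \<Omega>M fM) KM"
    unfolding KM \<Omega>M by (rule M.is_smallest_lipschitz_constant_box)
  have sV: "is_smallest (lipschitz_bound \<Omega>V fV) KV"
    unfolding KV \<Omega>V by (rule V.is_smallest_lipschitz_constant_box)
  have sN: "is_smallest (lipschitz_bound \<Omega> f) K"
    unfolding K \<Omega>_box by (rule N.is_smallest_lipschitz_constant_box)
  have same_bounds: "one_sided_lipschitz_bound \<Omega> f = lipschitz_bound \<Omega> f"
    unfolding \<Omega>_box using links by (intro N.one_sided_lipschitz_bound_eq_lipschitz_bound) linarith
  then have "L = K" unfolding K L one_sided_lipschitz_constant_def lipschitz_constant_def by simp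
  have "lipschitz_bound \<Omega> f k \<longleftrightarrow>
      lipschitz_bound \<Omega>P fP k \<and> lipschitz_bound \<Omega>M fM k \<and> lipschitz_bound \<Omega>V fV k" for k
    unfolding \<Omega>_box \<Omega>P \<Omega>M \<Omega>V N.lipschitz_bound_iff P.lipschitz_bound_iff M.lipschitz_bound_iff
      V.lipschitz_bound_iff all_less_add_iff
    by auto
  \<comment> \<open>\<open>K\<close> and the maximum have the same upper bounds, namely the bounds admissible for all blocks.\<close>
  then have "K \<le> k \<longleftrightarrow> Max {KP, KM, KV} \<le> k" for k
    using lipschitz_bound_iff_ge_smallest[OF sP] lipschitz_bound_iff_ge_smallest[OF sM]
      lipschitz_bound_iff_ge_smallest[OF sV] lipschitz_bound_iff_ge_smallest[OF sN]
    by simp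
  then have "K = Max {KP, KM, KV}" by (metis order_antisym order_refl)
  then show ?thesis using sP sM sV sN same_bounds \<open>L = K\<close> by simp
qed

end
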